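(* Let $k\le m$, let $\mathbf{V}\in\mathbb{R}^{m\times k}$ have orthonormal columns ($\mathbf{V}^T\mathbf{V}=\mathbf{I}_k$), and let $\mathbf{A}\in\mathbb{R}^{m\times m}$ be symmetric positive semi-definite. Then $\mathbf{V}^T\mathbf{A}\mathbf{V}$ is also symmetric positive semi-definite. *)

theory Defs
  imports Complex_Main "Jordan_Normal_Form.Matrix"
begin

text \<open>
  Positive semi-definiteness is a property of the quadratic form only; symmetry is a separate
  notion.  The dimension is read off from the rows, so squareness has to be required explicitly.
\<close>

definition symmetric_matrix :: "'a mat \<Rightarrow> bool" where
  "symmetric_matrix A \<longleftrightarrow> transpose_mat A = A"

definition pos_semidefinite :: "real mat \<Rightarrow> bool" where
  "pos_semidefinite A \<longleftrightarrow>
     square_mat A \<and> (\<forall>x \<in> carrier_vec (dim_row A). 0 \<le> x \<bullet> (A *\<^sub>v x))"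

end

theory Submission
  imports Defs
begin

text \<open>Passing from \<open>A\<close> to \<open>transpose_mat V * A * V\<close> substitutes
  \<open>V *\<^sub>v x\<close> for \<open>x\<close> in the quadratic form, so each value of the new
  form is a value of the old one and is nonnegative (\<open>pos_semidefinite_congruence\<close>).
  Symmetry survives because transposition reverses the product, swapping the two outer factors and
  fixing \<open>A\<close> (\<open>symmetric_matrix_congruence\<close>).\<close>

lemma symmetric_matrix_congruence:
  fixes A V :: "'a :: comm_semiring_0 mat"
  assumes V: "V \<in> carrier_mat m k" and A: "A \<in> carrier_mat m m"
    and sym: "symmetric_matrix A"
  shows "symmetric_matrix (transpose_mat V * A * V)"
proof -
  have "transpose_mat (transpose_mat V * A * V)
      = transpose_mat V * transpose_mat (transpose_mat V * A)"
    using V A by (intro transpose_mult) auto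
  also have "transpose_mat (transpose_mat V * A) = transpose_mat A * V"
    using V A by (subst transpose_mult) auto
  also have "transpose_mat V * (transpose_mat A * V) = transpose_mat V * A * V"
    \<comment> \<open>The dimensions occur only in the premises of associativity, so rewriting
      cannot find them by matching; they are supplied by hand.\<close>
    using V A sym by (simp add: symmetric_matrix_def assoc_mult_mat[of _ k m _ m _ k])
  finally show ?thesis by (simp add: symmetric_matrix_def)
qed

lemma pos_semidefinite_congruence:
  assumes V: "V \<in> carrier_mat m k" and A: "A \<in> carrier_mat m m"
    and psd: "pos_semidefinite A"
  shows "pos_semidefinite (transpose_mat V * A * V)"
  unfolding pos_semidefinite_def
proof (intro conjI ballI)
  show "square_mat (transpose_mat V * A * V)"
    using V by simp
next
  fix x :: "real vec" assume "x \<in> carrier_vec (dim_row (transpose_mat V * A * V))"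
  then have x: "x \<in> carrier_vec k" using V by simp
  have Vx: "V *\<^sub>v x \<in> carrier_vec m" using V x by simp
  have AVx: "A *\<^sub>v (V *\<^sub>v x) \<in> carrier_vec m" using A Vx by simp
  have VT: "transpose_mat V \<in> carrier_mat k m" using V by simp
  have "transpose_mat V * A * V *\<^sub>v x = transpose_mat V *\<^sub>v (A *\<^sub>v (V *\<^sub>v x))"
    using assoc_mult_mat_vec[OF mult_carrier_mat[OF VT A] V x]
      assoc_mult_mat_vec[OF VT A Vx] by simp
  \<comment> \<open>The factors are swapped so that the transpose stands on the left, ready for the
    adjoint identity that moves \<open>V\<close> onto \<open>x\<close>.\<close>
  then have "x \<bullet> (transpose_mat V * A * V *\<^sub>v x) = (transpose_mat V *\<^sub>v (A *\<^sub>v (V *\<^sub>v x))) \<bullet> x"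
    using comm_scalar_prod[OF x mult_mat_vec_carrier[OF VT AVx]] by simp
  also have "\<dots> = (A *\<^sub>v (V *\<^sub>v x)) \<bullet> (V *\<^sub>v x)"
    by (rule transpose_vec_mult_scalar[OF V x AVx])
  also have "\<dots> = (V *\<^sub>v x) \<bullet> (A *\<^sub>v (V *\<^sub>v x))"
    by (rule comm_scalar_prod[OF AVx Vx])
  \<comment> \<open>This is the form of \<open>A\<close> at the vector \<open>V *\<^sub>v x\<close>,
    whose length \<open>m\<close> is \<open>dim_row A\<close>.\<close>
  also have "\<dots> \<ge> 0"
    using psd A Vx by (simp add: pos_semidefinite_def)
  finally show "0 \<le> x \<bullet> (transpose_mat V * A * V *\<^sub>v x)" .
qed

theorem mainTheorem3:
  fixes k m :: nat
    and V A :: "real mat"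
  assumes "k \<le> m"
    and "V \<in> carrier_mat m k"
    and "transpose_mat V * V = 1\<^sub>m k"
    and "A \<in> carrier_mat m m"
    and "symmetric_matrix A"
    and "pos_semidefinite A"
  shows "symmetric_matrix (transpose_mat V * A * V)
       \<and> pos_semidefinite (transpose_mat V * A * V)"
  using assms symmetric_matrix_congruence pos_semidefinite_congruence by blast

end
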